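(* Let $n\ge1$. There are maps $$\circ:\mathrm{P}\mathrm{P}[n,\widetilde n]\times\mathrm{P}\mathrm{P}[n,\widetilde n]\to\mathrm{P}\mathrm{P}[n,\widetilde n]\qquad\text{and}\qquad\circ:\mathrm{P}\mathrm{P}[n,\widetilde n]\times\mathrm{P}\mathrm{P}[n]\to\mathrm{P}\mathrm{P}[n],$$ turning $\mathrm{P}\mathrm{P}[n,\widetilde n]$ into a $\mathbb{Z}_2$-algebra and $\mathrm{P}\mathrm{P}[n]$ into a module over $\mathrm{P}\mathrm{P}[n,\widetilde n]$, such that the pair $(\mathrm{P}\mathrm{P}[n,\widetilde n],\mathrm{P}\mathrm{P}[n])$ is isomorphic to $\left(\mathrm{End}_{\mathbb{Z}_2}(\mathrm{M}(\mathbb{Z}_2^n,\mathbb{Z}_2)),\mathrm{M}(\mathbb{Z}_2^n,\mathbb{Z}_2)\right)$ via the maps $$A\mapsto\sum_{a\in A}m^{a_1}\partial^{a_2}\qquad\text{and}\qquad F\mapsto\sum_{a\in F}m^a.$$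
   Context: $\mathbb{Z}_2=\{0,1\}$ is the field with two elements, $[n]=\{1,\dots,n\}$, $\mathrm{P}(y)$ is the set of subsets of $y$, and $\mathrm{P}\mathrm{P}(y)=\mathrm{P}(\mathrm{P}(y))$. $[n,\widetilde n]=\{1,\dots,n,\widetilde1,\dots,\widetilde n\}$ is the disjoint union of two copies of $[n]$; for $a\subseteq[n]$, $\widetilde a=\{\widetilde i\mid i\in a\}$. Each $a\in\mathrm{P}[n,\widetilde n]$ is written uniquely as $a=a_1\sqcup\widetilde a_2$ with $a_1,a_2\in\mathrm{P}[n]$. The additive structure on $\mathrm{P}\mathrm{P}[n,\widetilde n]$ and on $\mathrm{P}\mathrm{P}[n]$ is the symmetric difference $A+B=(A\cup B)\setminus(A\cap B)$. $\mathrm{M}(\mathbb{Z}_2^n,\mathbb{Z}_2)$ is the $\mathbb{Z}_2$-algebra of all maps $\mathbb{Z}_2^n\to\mathbb{Z}_2$; it is a module over its algebra of $\mathbb{Z}_2$-linear endomorphisms $\mathrm{End}_{\mathbb{Z}_2}(\mathrm{M}(\mathbb{Z}_2^n,\mathbb{Z}_2))$ by evaluation. Identify $\mathrm{P}[n]$ with $\mathbb{Z}_2^n$ via indicator vectors. For $a\in\mathrm{P}[n]$, $m^a$ is the function with $m^a(b)=1$ if $b=a$ and $0$ otherwise, also viewed as the operator of multiplication by it; $\partial^a=\prod_{i\in a}\partial_i$ where $\partial_if(x)=f(x+e_i)+f(x)$ and $e_i$ is the vector whose only nonzero entry is at position $i$. Pairs $(A,M)$ consist of a $\mathbb{Z}_2$-algebra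 $A$ and an $A$-module $M$; a morphism $(f,g):(A_1,M_1)\to(A_2,M_2)$ consists of $\mathbb{Z}_2$-linear maps $f:A_1\to A_2$, $g:M_1\to M_2$ with $f$ an algebra morphism and $g(am)=f(a)g(m)$. *)

theory Defs
  imports
    "HOL-Analysis.Finite_Cartesian_Product"
    "HOL-Library.Z2"
    "HOL-Algebra.Algebraic_Closure_Type"
begin

section \<open>Algebras, modules over them, and morphisms of pairs\<close>

text \<open>
  The library locale \<open>algebra\<close> of HOL-Algebra requires a commutative multiplication, and its locale
  \<open>module\<close> a commutative base ring, so the associative unital algebras and the left modules over
  them that are needed here are defined below, on top of the library's \<open>module\<close> record.
  The qualified name \<open>Module.module\<close> avoids the class-based locale of the same name.
\<close>

locale assoc_algebra = Module.module R A + ring A for R (structure) and A (structure) +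
  assumes smult_mult_left:
      "\<lbrakk>r \<in> carrier R; x \<in> carrier A; y \<in> carrier A\<rbrakk> \<Longrightarrow>
        (r \<odot>\<^bsub>A\<^esub> x) \<otimes>\<^bsub>A\<^esub> y = r \<odot>\<^bsub>A\<^esub> (x \<otimes>\<^bsub>A\<^esub> y)"
    and smult_mult_right:
      "\<lbrakk>r \<in> carrier R; x \<in> carrier A; y \<in> carrier A\<rbrakk> \<Longrightarrow>
        x \<otimes>\<^bsub>A\<^esub> (r \<odot>\<^bsub>A\<^esub> y) = r \<odot>\<^bsub>A\<^esub> (x \<otimes>\<^bsub>A\<^esub> y)"

text \<open>
  A pair consisting of an \<open>R\<close>-algebra \<open>A\<close> and an \<open>A\<close>-module \<open>M\<close>.  The ring multiplication and the
  unit of the record \<open>M\<close> are not used.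
\<close>

locale algebra_module_pair = A: assoc_algebra R A + M: Module.module R M
  for R :: "('r, 'u) ring_scheme" and A :: "('r, 'a, 'v) module_scheme"
    and M :: "('r, 'm, 'w) module_scheme" +
  fixes act :: "'a \<Rightarrow> 'm \<Rightarrow> 'm"
  assumes act_closed:
      "\<lbrakk>a \<in> carrier A; m \<in> carrier M\<rbrakk> \<Longrightarrow> act a m \<in> carrier M"
    and act_add_left:
      "\<lbrakk>a \<in> carrier A; b \<in> carrier A; m \<in> carrier M\<rbrakk> \<Longrightarrow>
        act (a \<oplus>\<^bsub>A\<^esub> b) m = act a m \<oplus>\<^bsub>M\<^esub> act b m"
    and act_add_right:
      "\<lbrakk>a \<in> carrier A; m \<in> carrier M; k \<in> carrier M\<rbrakk> \<Longrightarrow>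
        act a (m \<oplus>\<^bsub>M\<^esub> k) = act a m \<oplus>\<^bsub>M\<^esub> act a k"
    and act_smult_left:
      "\<lbrakk>r \<in> carrier R; a \<in> carrier A; m \<in> carrier M\<rbrakk> \<Longrightarrow>
        act (r \<odot>\<^bsub>A\<^esub> a) m = r \<odot>\<^bsub>M\<^esub> act a m"
    and act_smult_right:
      "\<lbrakk>r \<in> carrier R; a \<in> carrier A; m \<in> carrier M\<rbrakk> \<Longrightarrow>
        act a (r \<odot>\<^bsub>M\<^esub> m) = r \<odot>\<^bsub>M\<^esub> act a m"
    and act_mult:
      "\<lbrakk>a \<in> carrier A; b \<in> carrier A; m \<in> carrier M\<rbrakk> \<Longrightarrow>
        act (a \<otimes>\<^bsub>A\<^esub> b) m = act a (act b m)"
    and act_one: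
      "m \<in> carrier M \<Longrightarrow> act \<one>\<^bsub>A\<^esub> m = m"

definition linear_maps ::
  "('r, 'u) ring_scheme \<Rightarrow> ('r, 'a, 'v) module_scheme \<Rightarrow> ('r, 'b, 'w) module_scheme \<Rightarrow> ('a \<Rightarrow> 'b) set"
  where
  "linear_maps R M N = {f \<in> carrier M \<rightarrow> carrier N.
     (\<forall>x\<in>carrier M. \<forall>y\<in>carrier M. f (x \<oplus>\<^bsub>M\<^esub> y) = f x \<oplus>\<^bsub>N\<^esub> f y) \<and>
     (\<forall>r\<in>carrier R. \<forall>x\<in>carrier M. f (r \<odot>\<^bsub>M\<^esub> x) = r \<odot>\<^bsub>N\<^esub> f x)}"

definition pair_hom ::
  "('r, 'u) ring_scheme
    \<Rightarrow> ('r, 'a, 'v) module_scheme \<Rightarrow> ('r, 'm, 'w) module_scheme \<Rightarrow> ('a \<Rightarrow> 'm \<Rightarrow> 'm)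
    \<Rightarrow> ('r, 'b, 'x) module_scheme \<Rightarrow> ('r, 'k, 'y) module_scheme \<Rightarrow> ('b \<Rightarrow> 'k \<Rightarrow> 'k)
    \<Rightarrow> ('a \<Rightarrow> 'b) \<Rightarrow> ('m \<Rightarrow> 'k) \<Rightarrow> bool"
  where
  "pair_hom R A M act B N act' f g \<longleftrightarrow>
     algebra_module_pair R A M act \<and> algebra_module_pair R B N act' \<and>
     f \<in> linear_maps R A B \<and> f \<in> ring_hom A B \<and> g \<in> linear_maps R M N \<and>
     (\<forall>a\<in>carrier A. \<forall>m\<in>carrier M. g (act a m) = act' (f a) (g m))"

definition pair_iso ::
  "('r, 'u) ring_scheme
    \<Rightarrow> ('r, 'a, 'v) module_scheme \<Rightarrow> ('r, 'm, 'w) module_scheme \<Rightarrow> ('a \<Rightarrow> 'm \<Rightarrow> 'm)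
    \<Rightarrow> ('r, 'b, 'x) module_scheme \<Rightarrow> ('r, 'k, 'y) module_scheme \<Rightarrow> ('b \<Rightarrow> 'k \<Rightarrow> 'k)
    \<Rightarrow> ('a \<Rightarrow> 'b) \<Rightarrow> ('m \<Rightarrow> 'k) \<Rightarrow> bool"
  where
  "pair_iso R A M act B N act' f g \<longleftrightarrow>
     pair_hom R A M act B N act' f g \<and>
     (\<exists>f' g'. pair_hom R B N act' A M act f' g' \<and>
        (\<forall>a\<in>carrier A. f' (f a) = a) \<and> (\<forall>b\<in>carrier B. f (f' b) = b) \<and>
        (\<forall>m\<in>carrier M. g' (g m) = m) \<and> (\<forall>k\<in>carrier N. g (g' k) = k))"

abbreviation Z2 :: "bit ring" where
  "Z2 \<equiv> ring_of_type_algebra"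

section \<open>Families of sets under symmetric difference\<close>

text \<open>
  The index set \<open>[n]\<close> is rendered as a finite type \<open>'n\<close> and its disjoint double as the sum type
  \<open>'n + 'n\<close>, with \<open>Inr\<close> marking the second copy.  At the element type \<open>('n + 'n) set\<close> the structure
  below lives on families of subsets of the double, at \<open>'n set\<close> on families of subsets of \<open>[n]\<close>.
\<close>

definition symdiff_structure ::
  "('b set \<Rightarrow> 'b set \<Rightarrow> 'b set) \<Rightarrow> 'b set \<Rightarrow> (bit, 'b set) module"
  where
  "symdiff_structure mul u =
    \<lparr>carrier = UNIV, monoid.mult = mul, one = u, zero = {},
     add = (\<lambda>A B. (A \<union> B) - (A \<inter> B)),
     module.smult = (\<lambda>c A. if c = 1 then A else {})\<rparr>"

definition symdiff_module :: "(bit, 'b set) module" where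
  "symdiff_module = symdiff_structure undefined undefined"

section \<open>Functions on the Boolean cube and their endomorphisms\<close>

definition cube_functions :: "(bit, bit ^ 'n \<Rightarrow> bit) module" where
  "cube_functions =
    \<lparr>carrier = UNIV, monoid.mult = (\<lambda>f g x. f x * g x), one = (\<lambda>x. 1), zero = (\<lambda>x. 0),
     add = (\<lambda>f g x. f x + g x),
     module.smult = (\<lambda>c f x. c * f x)\<rparr>"

definition cube_End :: "(bit, (bit ^ 'n \<Rightarrow> bit) \<Rightarrow> (bit ^ 'n \<Rightarrow> bit)) module" where
  "cube_End =
    \<lparr>carrier = linear_maps Z2 cube_functions cube_functions,
     monoid.mult = (\<circ>), one = id, zero = (\<lambda>f. \<zero>\<^bsub>cube_functions\<^esub>),
     add = (\<lambda>S T f. S f \<oplus>\<^bsub>cube_functions\<^esub> T f),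
     module.smult = (\<lambda>c T f. c \<odot>\<^bsub>cube_functions\<^esub> T f)\<rparr>"

definition indicator_vec :: "'n set \<Rightarrow> bit ^ 'n" where
  "indicator_vec a = (\<chi> i. if i \<in> a then 1 else 0)"

definition delta_fun :: "'n set \<Rightarrow> bit ^ 'n \<Rightarrow> bit" where
  "delta_fun a = (\<lambda>x. if x = indicator_vec a then 1 else 0)"

definition mult_op :: "(bit ^ 'n \<Rightarrow> bit) \<Rightarrow> (bit ^ 'n \<Rightarrow> bit) \<Rightarrow> (bit ^ 'n \<Rightarrow> bit)" where
  "mult_op f = (\<lambda>g. f \<otimes>\<^bsub>cube_functions\<^esub> g)"

definition partial_op :: "'n \<Rightarrow> (bit ^ 'n \<Rightarrow> bit) \<Rightarrow> (bit ^ 'n \<Rightarrow> bit)" where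
  "partial_op i f = (\<lambda>x. f (x + axis i 1) + f x)"

text \<open>
  The product of the operators \<open>partial_op i\<close>, \<open>i \<in> a\<close>, in the noncommutative ring \<open>cube_End\<close>; the
  fold is independent of the order of the factors because these operators commute.
\<close>

definition partial_ops :: "'n::finite set \<Rightarrow> (bit ^ 'n \<Rightarrow> bit) \<Rightarrow> (bit ^ 'n \<Rightarrow> bit)" where
  "partial_ops a = Finite_Set.fold (\<lambda>i T. partial_op i \<otimes>\<^bsub>cube_End\<^esub> T) \<one>\<^bsub>cube_End\<^esub> a"

lemma partial_op_commute:
  "partial_op i \<circ> partial_op j = partial_op j \<circ> partial_op i"
  by (rule ext) (simp only: o_apply partial_op_def ac_simps)

lemma comp_fun_commute_partial_op:
  "comp_fun_commute (\<lambda>i T. partial_op i \<otimes>\<^bsub>cube_End\<^esub> T)"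
proof
  fix i j :: "'n::finite"
  have "partial_op i \<circ> (partial_op j \<circ> T) = partial_op j \<circ> (partial_op i \<circ> T)"
    for T :: "(bit ^ 'n \<Rightarrow> bit) \<Rightarrow> (bit ^ 'n \<Rightarrow> bit)"
    by (simp only: comp_assoc [symmetric] partial_op_commute)
  then show "(\<otimes>\<^bsub>cube_End\<^esub>) (partial_op j) \<circ> (\<otimes>\<^bsub>cube_End\<^esub>) (partial_op i) =
      (\<otimes>\<^bsub>cube_End\<^esub>) (partial_op i) \<circ> (\<otimes>\<^bsub>cube_End\<^esub>) (partial_op j)"
    by (simp add: fun_eq_iff cube_End_def)
qed

definition operator_of ::
  "('n::finite + 'n) set set \<Rightarrow> (bit ^ 'n \<Rightarrow> bit) \<Rightarrow> (bit ^ 'n \<Rightarrow> bit)"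
  where
  "operator_of A =
    (\<Oplus>\<^bsub>cube_End\<^esub>a\<in>A. mult_op (delta_fun (Inl -` a)) \<otimes>\<^bsub>cube_End\<^esub> partial_ops (Inr -` a))"

definition function_of :: "'n::finite set set \<Rightarrow> bit ^ 'n \<Rightarrow> bit" where
  "function_of F = (\<Oplus>\<^bsub>cube_functions\<^esub>a\<in>F. delta_fun a)"

end

theory Submission
  imports Defs
begin

text \<open>
  The whole content of the theorem is that \<open>operator_of\<close> is a bijection from families of subsets of
  the double onto the endomorphisms of the function space.  It is \<open>Z2\<close>-linear, because in
  characteristic two a sum over a symmetric difference is the sum of the two sums; likewise
  \<open>function_of\<close> is a linear bijection onto the functions.  The two products \<open>circ\<close> and \<open>circ_act\<close>
  are then what composition and evaluation become under these identifications.
  All axioms of an algebra and of a module then hold for families because they hold for operators;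
  this pulling back of axioms along a bijection is done for arbitrary pairs.

  The bijectivity of \<open>operator_of\<close> is a statement about matrices.  Expanding the product of the
  operators \<open>partial_op i\<close> (shift plus identity) over \<open>i \<in> a\<close> gives the sum of all shifts by
  subsets of \<open>a\<close> (\<open>partial_ops_apply\<close>), and the factor \<open>delta_fun c\<close> keeps only the value at the point \<open>c\<close>.  Hence the
  entry of \<open>operator_of A\<close> in row \<open>c\<close> and column \<open>c + d\<close> is the number, modulo two, of supersets
  \<open>e\<close> of \<open>d\<close> for which the pair \<open>(c, e)\<close> belongs to \<open>A\<close> (\<open>operator_of_delta\<close>).  Thus each row of
  the matrix is the superset sum of the characteristic function of the corresponding slice of \<open>A\<close>.
  By Moebius inversion, in which all signs disappear modulo two, forming superset sums is its own
  inverse (\<open>superset_sum_involution\<close>).  So every matrix arises from exactly one family, and since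
  an endomorphism is determined by its matrix, so does every endomorphism.
\<close>

section \<open>Pulling algebraic structure back along a bijection\<close>

text \<open>
  An equation holds in the source of an injective map as soon as its image holds in the target, so
  associativity, commutativity and neutrality are inherited.  Surjectivity provides the negatives,
  as preimages of negatives.
\<close>

lemma abelian_group_pullback:
  assumes N: "abelian_group N"
    and bij: "bij_betw g (carrier M) (carrier N)"
    and add_closed: "\<And>x y. \<lbrakk>x \<in> carrier M; y \<in> carrier M\<rbrakk> \<Longrightarrow> x \<oplus>\<^bsub>M\<^esub> y \<in> carrier M"
    and zero_closed: "\<zero>\<^bsub>M\<^esub> \<in> carrier M"
    and hom_add: "\<And>x y. \<lbrakk>x \<in> carrier M; y \<in> carrier M\<rbrakk> \<Longrightarrow> g (x \<oplus>\<^bsub>M\<^esub> y) = g x \<oplus>\<^bsub>N\<^esub> g y"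
    and hom_zero: "g \<zero>\<^bsub>M\<^esub> = \<zero>\<^bsub>N\<^esub>"
  shows "abelian_group M"
proof -
  interpret N: abelian_group N by (rule N)
  note closed = add_closed zero_closed
  note hom = hom_add hom_zero
  have inj: "inj_on g (carrier M)" and im: "g ` carrier M = carrier N"
    using bij by (auto simp: bij_betw_def)
  have in_N [simp]: "g x \<in> carrier N" if "x \<in> carrier M" for x
    using that im by auto
  show ?thesis
  proof (rule abelian_groupI)
    fix x assume x: "x \<in> carrier M"
    have "\<ominus>\<^bsub>N\<^esub> g x \<in> g ` carrier M"
      using x im by simp
    then obtain y where y: "y \<in> carrier M" "g y = \<ominus>\<^bsub>N\<^esub> g x"
      by auto
    have "y \<oplus>\<^bsub>M\<^esub> x = \<zero>\<^bsub>M\<^esub>"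
      by (rule inj_onD[OF inj]) (use x y in \<open>simp_all add: closed hom N.l_neg\<close>)
    then show "\<exists>y\<in>carrier M. y \<oplus>\<^bsub>M\<^esub> x = \<zero>\<^bsub>M\<^esub>"
      using y by blast
  next
    fix x y z assume "x \<in> carrier M" "y \<in> carrier M" "z \<in> carrier M"
    then show "x \<oplus>\<^bsub>M\<^esub> y \<oplus>\<^bsub>M\<^esub> z = x \<oplus>\<^bsub>M\<^esub> (y \<oplus>\<^bsub>M\<^esub> z)"
      by (intro inj_onD[OF inj]) (simp_all add: closed hom N.a_assoc)
  next
    fix x y assume "x \<in> carrier M" "y \<in> carrier M"
    then show "x \<oplus>\<^bsub>M\<^esub> y = y \<oplus>\<^bsub>M\<^esub> x"
      by (intro inj_onD[OF inj]) (simp_all add: closed hom N.a_comm)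
  next
    fix x assume "x \<in> carrier M"
    then show "\<zero>\<^bsub>M\<^esub> \<oplus>\<^bsub>M\<^esub> x = x"
      by (intro inj_onD[OF inj]) (simp_all add: closed hom)
  qed (simp_all add: closed)
qed

lemma linear_mapsD:
  assumes "g \<in> linear_maps R M N"
  shows "x \<in> carrier M \<Longrightarrow> g x \<in> carrier N"
    and "\<lbrakk>x \<in> carrier M; y \<in> carrier M\<rbrakk> \<Longrightarrow> g (x \<oplus>\<^bsub>M\<^esub> y) = g x \<oplus>\<^bsub>N\<^esub> g y"
    and "\<lbrakk>r \<in> carrier R; x \<in> carrier M\<rbrakk> \<Longrightarrow> g (r \<odot>\<^bsub>M\<^esub> x) = r \<odot>\<^bsub>N\<^esub> g x"
  using assms by (auto simp: linear_maps_def)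

lemma module_pullback:
  assumes N: "Module.module R N"
    and bij: "bij_betw g (carrier M) (carrier N)"
    and lin: "g \<in> linear_maps R M N"
    and add_closed: "\<And>x y. \<lbrakk>x \<in> carrier M; y \<in> carrier M\<rbrakk> \<Longrightarrow> x \<oplus>\<^bsub>M\<^esub> y \<in> carrier M"
    and zero_closed: "\<zero>\<^bsub>M\<^esub> \<in> carrier M"
    and smult_closed: "\<And>r x. \<lbrakk>r \<in> carrier R; x \<in> carrier M\<rbrakk> \<Longrightarrow> r \<odot>\<^bsub>M\<^esub> x \<in> carrier M"
    and hom_zero: "g \<zero>\<^bsub>M\<^esub> = \<zero>\<^bsub>N\<^esub>"
  shows "Module.module R M"
proof -
  interpret N: Module.module R N by (rule N)
  note hom = linear_mapsD[OF lin]
  have inj: "inj_on g (carrier M)"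
    using bij by (simp add: bij_betw_def)
  show ?thesis
  proof (rule moduleI)
    show "abelian_group M"
      by (rule abelian_group_pullback[OF N.abelian_group_axioms bij])
        (simp_all add: add_closed zero_closed hom hom_zero)
  qed (auto intro!: inj_onD[OF inj] N.is_cring
      simp: add_closed smult_closed hom N.smult_l_distr N.smult_r_distr N.smult_assoc1)
qed

lemma assoc_algebra_pullback:
  assumes B: "assoc_algebra R B"
    and bij: "bij_betw f (carrier A) (carrier B)"
    and lin: "f \<in> linear_maps R A B" and rhom: "f \<in> ring_hom A B"
    and add_closed: "\<And>x y. \<lbrakk>x \<in> carrier A; y \<in> carrier A\<rbrakk> \<Longrightarrow> x \<oplus>\<^bsub>A\<^esub> y \<in> carrier A"
    and mult_closed: "\<And>x y. \<lbrakk>x \<in> carrier A; y \<in> carrier A\<rbrakk> \<Longrightarrow> x \<otimes>\<^bsub>A\<^esub> y \<in> carrier A"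
    and unit_closed: "\<zero>\<^bsub>A\<^esub> \<in> carrier A" "\<one>\<^bsub>A\<^esub> \<in> carrier A"
    and smult_closed: "\<And>r x. \<lbrakk>r \<in> carrier R; x \<in> carrier A\<rbrakk> \<Longrightarrow> r \<odot>\<^bsub>A\<^esub> x \<in> carrier A"
    and hom_zero: "f \<zero>\<^bsub>A\<^esub> = \<zero>\<^bsub>B\<^esub>"
  shows "assoc_algebra R A"
proof -
  interpret B: assoc_algebra R B by (rule B)
  note hom = linear_mapsD[OF lin] ring_hom_mult[OF rhom] ring_hom_one[OF rhom]
  note closed = add_closed mult_closed unit_closed smult_closed
  have inj: "inj_on f (carrier A)"
    using bij by (simp add: bij_betw_def)
  have A_module: "Module.module R A"
    by (rule module_pullback[OF B.module_axioms bij lin]) (simp_all add: closed hom_zero)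
  then interpret A: Module.module R A .
  have A_ring: "ring A"
    by (rule ringI[OF A.abelian_group_axioms monoidI])
      (auto intro!: inj_onD[OF inj] simp: closed hom B.m_assoc B.l_distr B.r_distr)
  show ?thesis
    by (intro assoc_algebra.intro assoc_algebra_axioms.intro A_module A_ring)
      (auto intro!: inj_onD[OF inj]
        simp: closed hom B.smult_mult_left B.smult_mult_right)
qed

text \<open>
  The module axioms for \<open>act\<close> are equations in \<open>M\<close>; injectivity of \<open>g\<close> carries them over from
  \<open>act'\<close>.  Besides the morphism, this yields that \<open>act\<close> is an action, as part of \<open>pair_hom\<close>.
\<close>

lemma pair_hom_pullback:
  assumes pair: "algebra_module_pair R B N act'"
    and A: "assoc_algebra R A" and M: "Module.module R M"
    and f: "f \<in> linear_maps R A B" "f \<in> ring_hom A B"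
    and g: "g \<in> linear_maps R M N" and inj: "inj_on g (carrier M)"
    and act_closed: "\<And>a m. \<lbrakk>a \<in> carrier A; m \<in> carrier M\<rbrakk> \<Longrightarrow> act a m \<in> carrier M"
    and act_hom: "\<And>a m. \<lbrakk>a \<in> carrier A; m \<in> carrier M\<rbrakk> \<Longrightarrow> g (act a m) = act' (f a) (g m)"
  shows "pair_hom R A M act B N act' f g"
proof -
  interpret P: algebra_module_pair R B N act' by (rule pair)
  interpret A: assoc_algebra R A by (rule A)
  interpret M: Module.module R M by (rule M)
  note hom = linear_mapsD[OF f(1)] ring_hom_mult[OF f(2)] ring_hom_one[OF f(2)]
    linear_mapsD[OF g] act_hom
  have "algebra_module_pair R A M act"
    by (intro algebra_module_pair.intro algebra_module_pair_axioms.intro A M)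
      (auto intro!: inj_onD[OF inj] act_closed
        simp: act_closed hom P.act_add_left P.act_add_right P.act_smult_left
          P.act_smult_right P.act_mult P.act_one)
  then show ?thesis
    using f g pair by (auto simp: pair_hom_def act_hom)
qed

lemma linear_maps_inv_into:
  assumes M: "Module.module R M"
    and bij: "bij_betw g (carrier M) (carrier N)"
    and lin: "g \<in> linear_maps R M N"
  shows "inv_into (carrier M) g \<in> linear_maps R N M"
proof -
  interpret M: Module.module R M by (rule M)
  note hom = linear_mapsD[OF lin]
  have inj: "inj_on g (carrier M)" using bij by (simp add: bij_betw_def)
  have inv: "inv_into (carrier M) g y \<in> carrier M" "g (inv_into (carrier M) g y) = y"
    if "y \<in> carrier N" for y
    using that bij by (auto simp: bij_betw_def inv_into_into f_inv_into_f)
  show ?thesis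
    unfolding linear_maps_def
    by (auto simp: inv hom intro!: inv_into_f_eq[OF inj])
qed

lemma pair_iso_of_bijective_hom:
  assumes hom: "pair_hom R A M act B N act' f g"
    and f: "bij_betw f (carrier A) (carrier B)" and g: "bij_betw g (carrier M) (carrier N)"
  shows "pair_iso R A M act B N act' f g"
proof -
  let ?f = "inv_into (carrier A) f" and ?g = "inv_into (carrier M) g"
  have pairs: "algebra_module_pair R A M act" "algebra_module_pair R B N act'"
    and lin: "f \<in> linear_maps R A B" "g \<in> linear_maps R M N" and rhom: "f \<in> ring_hom A B"
    and act_hom: "\<And>a m. \<lbrakk>a \<in> carrier A; m \<in> carrier M\<rbrakk> \<Longrightarrow> g (act a m) = act' (f a) (g m)"
    using hom by (auto simp: pair_hom_def)
  interpret P: algebra_module_pair R A M act by (rule pairs)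
  have inj: "inj_on f (carrier A)" "inj_on g (carrier M)"
    using f g by (auto simp: bij_betw_def)
  have inv_f: "?f b \<in> carrier A" "f (?f b) = b" if "b \<in> carrier B" for b
    using that f by (auto simp: bij_betw_def inv_into_into f_inv_into_f)
  have inv_g: "?g k \<in> carrier M" "g (?g k) = k" if "k \<in> carrier N" for k
    using that g by (auto simp: bij_betw_def inv_into_into f_inv_into_f)
  have "?f \<in> ring_hom B A"
    by (rule ring_hom_memI)
      (auto intro!: inv_into_f_eq[OF inj(1)]
        simp: inv_f ring_hom_mult[OF rhom] ring_hom_add[OF rhom] ring_hom_one[OF rhom])
  moreover have "?g (act' b k) = act (?f b) (?g k)" if "b \<in> carrier B" "k \<in> carrier N" for b k
    using that by (auto intro!: inv_into_f_eq[OF inj(2)] P.act_closed simp: inv_f inv_g act_hom)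
  ultimately have "pair_hom R B N act' A M act ?f ?g"
    using pairs linear_maps_inv_into[OF _ f lin(1)] linear_maps_inv_into[OF _ g lin(2)]
      P.A.module_axioms P.M.module_axioms
    by (auto simp: pair_hom_def)
  then show ?thesis
    using hom inj inv_f inv_g by (auto simp: pair_iso_def intro!: exI[of _ ?f] exI[of _ ?g])
qed

section \<open>Functions on the cube and their endomorphisms\<close>

text \<open>
  The default simplification rules turn sums and products of bits into bit operations, on which the
  ring rules and the rules for finite sums do not act.
\<close>

declare add_bit_eq_xor [simp del] mult_bit_eq_and [simp del]

lemma bit_add_self [simp]: "b + b = (0 :: bit)"
  by (cases b) auto

lemma of_bool_eq_one: "of_bool (b = 1) = (b :: bit)"
  by (cases b) simp_all

lemma carrier_Z2 [simp]: "carrier Z2 = UNIV"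
  by (simp add: ring_of_type_algebra_def)

lemma cring_Z2: "cring Z2"
  by (rule cring_from_type_algebra)

lemma module_cube_functions: "Module.module Z2 cube_functions"
proof (rule moduleI[OF cring_Z2 abelian_groupI])
  fix f :: "bit ^ 'n \<Rightarrow> bit"
  have "f \<oplus>\<^bsub>cube_functions\<^esub> f = \<zero>\<^bsub>cube_functions\<^esub>"
    by (simp add: cube_functions_def)
  then show "\<exists>g\<in>carrier cube_functions. g \<oplus>\<^bsub>cube_functions\<^esub> f = \<zero>\<^bsub>cube_functions\<^esub>"
    by (intro bexI[of _ f]) (simp_all add: cube_functions_def)
qed (auto simp: cube_functions_def ring_of_type_algebra_def fun_eq_iff algebra_simps)

lemma carrier_cube_functions [simp]: "carrier cube_functions = UNIV"
  by (simp add: cube_functions_def)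

text \<open>
  Over the field with two elements additivity alone implies linearity, as the only scalars are
  \<open>0\<close> and \<open>1\<close>.
\<close>

lemma carrier_cube_End:
  "T \<in> carrier cube_End \<longleftrightarrow> (\<forall>f g. T (\<lambda>x. f x + g x) = (\<lambda>x. T f x + T g x))"
    (is "_ \<longleftrightarrow> ?additive")
proof
  assume ?additive
  then have add: "T (\<lambda>x. f x + g x) = (\<lambda>x. T f x + T g x)" for f g
    by blast
  have "T (\<lambda>x. 0) = (\<lambda>x. 0)"
    using add[of "\<lambda>x. 0" "\<lambda>x. 0"] by simp
  then have "T (\<lambda>x. c * f x) = (\<lambda>x. c * T f x)" for c f
    by (cases c) simp_all
  then show "T \<in> carrier cube_End"
    by (simp add: cube_End_def linear_maps_def cube_functions_def add)
qed (simp add: cube_End_def linear_maps_def cube_functions_def)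

lemma
  assumes "T \<in> carrier cube_End"
  shows cube_End_add: "T (\<lambda>x. f x + g x) = (\<lambda>x. T f x + T g x)"
    and cube_End_zero: "T (\<lambda>x. 0) = (\<lambda>x. 0)"
    and cube_End_smult: "T (\<lambda>x. c * f x) = (\<lambda>x. c * T f x)"
proof -
  show add: "T (\<lambda>x. f x + g x) = (\<lambda>x. T f x + T g x)" for f g
    using assms by (simp add: carrier_cube_End)
  show zero: "T (\<lambda>x. 0) = (\<lambda>x. 0)"
    using add[of "\<lambda>x. 0" "\<lambda>x. 0"] by simp
  show "T (\<lambda>x. c * f x) = (\<lambda>x. c * T f x)"
    by (cases c) (simp_all add: zero)
qed

lemma cube_End_simps:
  "\<zero>\<^bsub>cube_End\<^esub> = (\<lambda>f x. 0)" "\<one>\<^bsub>cube_End\<^esub> = id"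
  "S \<oplus>\<^bsub>cube_End\<^esub> T = (\<lambda>f x. S f x + T f x)" "S \<otimes>\<^bsub>cube_End\<^esub> T = S \<circ> T"
  "c \<odot>\<^bsub>cube_End\<^esub> T = (\<lambda>f x. c * T f x)"
  by (simp_all add: cube_End_def cube_functions_def)

lemma assoc_algebra_cube_End: "assoc_algebra Z2 cube_End"
proof -
  have grp: "abelian_group cube_End"
  proof (rule abelian_groupI)
    fix T :: "(bit ^ 'n \<Rightarrow> bit) \<Rightarrow> (bit ^ 'n \<Rightarrow> bit)"
    assume "T \<in> carrier cube_End"
    then show "\<exists>S\<in>carrier cube_End. S \<oplus>\<^bsub>cube_End\<^esub> T = \<zero>\<^bsub>cube_End\<^esub>"
      by (auto simp: cube_End_simps intro: bexI[of _ T])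
  qed (auto simp: carrier_cube_End cube_End_simps ac_simps)
  have mon: "monoid cube_End"
    by (rule monoidI) (auto simp: carrier_cube_End cube_End_simps)
  show ?thesis
    by (intro assoc_algebra.intro assoc_algebra_axioms.intro moduleI cring_Z2 ringI grp mon)
      (auto simp: carrier_cube_End cube_End_simps cube_End_smult[unfolded carrier_cube_End]
        ring_of_type_algebra_def algebra_simps)
qed

lemma algebra_module_pair_cube:
  "algebra_module_pair Z2 cube_End cube_functions (\<lambda>T f. T f)"
  by (intro algebra_module_pair.intro algebra_module_pair_axioms.intro
      assoc_algebra_cube_End module_cube_functions)
    (auto simp: cube_End_simps cube_functions_def cube_End_add cube_End_smult)

lemma finsum_cube_functions:
  fixes h :: "'i \<Rightarrow> bit ^ 'n::finite \<Rightarrow> bit"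
  assumes "finite F"
  shows "(\<Oplus>\<^bsub>cube_functions\<^esub>a\<in>F. h a) = (\<lambda>x. \<Sum>a\<in>F. h a x)"
  using assms
proof (induction F rule: finite_induct)
  interpret Module.module Z2 "cube_functions :: (bit, bit ^ 'n \<Rightarrow> bit) module"
    by (rule module_cube_functions)
  {
    case empty
    show ?case by (simp only: finsum_empty) (simp add: cube_functions_def)
  next
    case (insert a F)
    then show ?case by (simp add: finsum_insert) (simp add: cube_functions_def)
  }
qed

lemma finsum_cube_End:
  fixes h :: "'i \<Rightarrow> (bit ^ 'n::finite \<Rightarrow> bit) \<Rightarrow> bit ^ 'n \<Rightarrow> bit"
  assumes "finite F" "\<And>a. a \<in> F \<Longrightarrow> h a \<in> carrier cube_End"
  shows "(\<Oplus>\<^bsub>cube_End\<^esub>a\<in>F. h a) = (\<lambda>f x. \<Sum>a\<in>F. h a f x)"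
  using assms
proof (induction F rule: finite_induct)
  interpret assoc_algebra Z2 "cube_End :: (bit, (bit ^ 'n \<Rightarrow> bit) \<Rightarrow> _) module"
    by (rule assoc_algebra_cube_End)
  {
    case empty
    show ?case by (simp add: cube_End_simps)
  next
    case (insert a F)
    then show ?case by (simp add: finsum_insert Pi_iff) (simp add: cube_End_simps)
  }
qed

section \<open>Functions as families of subsets\<close>

lemma indicator_vec_eq_iff [simp]: "indicator_vec a = indicator_vec b \<longleftrightarrow> a = b"
  by (auto simp: indicator_vec_def vec_eq_iff set_eq_iff split: if_splits)

lemma surj_indicator_vec: "\<exists>a. x = indicator_vec a"
  \<comment> \<open>The witness is the support of \<open>x\<close>.\<close>
  by (rule exI[of _ "{i. vec_nth x i = 1}"]) (simp add: indicator_vec_def vec_eq_iff)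

lemma indicator_vec_add: "indicator_vec a + indicator_vec b = indicator_vec (sym_diff a b)"
  by (auto simp: indicator_vec_def vec_eq_iff)

lemma cube_function_eqI:
  assumes "\<And>c. f (indicator_vec c) = g (indicator_vec c)"
  shows "f = g"
  using assms surj_indicator_vec by (metis ext)

lemma delta_fun_indicator_vec: "delta_fun a (indicator_vec c) = of_bool (c = a)"
  by (simp add: delta_fun_def)

lemma function_of_eq_sum: "function_of F = (\<lambda>x. \<Sum>a\<in>F. delta_fun a x)"
  by (simp add: function_of_def finsum_cube_functions)

lemma function_of_indicator_vec: "function_of F (indicator_vec c) = of_bool (c \<in> F)"
  by (simp add: function_of_eq_sum delta_fun_indicator_vec of_bool_def)

lemma bij_function_of: "bij function_of"
proof (rule bijI')
  fix F G :: "'a set set"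
  show "function_of F = function_of G \<longleftrightarrow> F = G"
  proof
    assume eq: "function_of F = function_of G"
    have "c \<in> F \<longleftrightarrow> c \<in> G" for c
      using fun_cong[OF eq, of "indicator_vec c"] by (simp add: function_of_indicator_vec of_bool_eq_iff)
    then show "F = G" by blast
  qed simp
next
  fix f :: "bit ^ 'a \<Rightarrow> bit"
  have "f = function_of {a. f (indicator_vec a) = 1}"
    by (rule cube_function_eqI) (simp add: function_of_indicator_vec of_bool_def)
  then show "\<exists>F. f = function_of F" by blast
qed

lemma cube_End_sum:
  assumes "T \<in> carrier cube_End" "finite F"
  shows "T (\<lambda>x. \<Sum>a\<in>F. h a x) = (\<lambda>x. \<Sum>a\<in>F. T (h a) x)"
  using assms(2)
  by (induction F rule: finite_induct)
    (simp_all add: cube_End_add[OF assms(1)] cube_End_zero[OF assms(1)])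

text \<open>
  The functions \<open>delta_fun a\<close> span the function space, so an endomorphism is determined by its matrix
  with respect to them.
\<close>

lemma cube_End_eqI:
  fixes S T :: "(bit ^ 'n::finite \<Rightarrow> bit) \<Rightarrow> bit ^ 'n \<Rightarrow> bit"
  assumes "S \<in> carrier cube_End" "T \<in> carrier cube_End"
    and delta: "\<And>a c. S (delta_fun a) (indicator_vec c) = T (delta_fun a) (indicator_vec c)"
  shows "S = T"
proof
  fix f :: "bit ^ 'n \<Rightarrow> bit"
  obtain F where f: "f = (\<lambda>x. \<Sum>a\<in>F. delta_fun a x)"
    using bij_function_of by (metis bij_pointE function_of_eq_sum)
  show "S f = T f"
    by (rule cube_function_eqI) (simp add: f assms(1,2) cube_End_sum delta)
qed

section \<open>Operators as families of subsets of the double\<close>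

text \<open>
  With \<open>partial_op i\<close> written as the identity plus the shift by the \<open>i\<close>-th unit vector, multiplying
  out the product over \<open>i \<in> a\<close> amounts to choosing the set \<open>b\<close> of those \<open>i\<close> for which the shift is
  taken.
\<close>

lemma partial_ops_apply:
  "partial_ops a f x = (\<Sum>b\<in>Pow a. f (x + indicator_vec b))"
proof -
  interpret comp_fun_commute "\<lambda>i T. partial_op i \<otimes>\<^bsub>cube_End\<^esub> T"
    by (rule comp_fun_commute_partial_op)
  have "finite a" by simp
  then show ?thesis
  proof (induction a arbitrary: x rule: finite_induct)
    case empty
    have "x + indicator_vec {} = x" by (simp add: indicator_vec_def vec_eq_iff)
    then show ?case by (simp add: partial_ops_def cube_End_simps)
  next
    case (insert i a)
    have shift: "indicator_vec (insert i b) = axis i 1 + indicator_vec b" if "b \<in> Pow a" for b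
      using that insert.hyps by (auto simp: indicator_vec_def vec_eq_iff axis_def)
    have "partial_ops (insert i a) = partial_op i \<otimes>\<^bsub>cube_End\<^esub> partial_ops a"
      unfolding partial_ops_def by (rule fold_insert[OF insert.hyps])
    then have "partial_ops (insert i a) f x = partial_op i (partial_ops a f) x"
      by (simp add: cube_End_simps)
    also have "\<dots> = (\<Sum>b\<in>Pow a. f (x + indicator_vec b))
        + (\<Sum>b\<in>Pow a. f (x + indicator_vec (insert i b)))"
      by (simp add: partial_op_def insert.IH shift ac_simps)
    also have "\<dots> = (\<Sum>b\<in>Pow (insert i a). f (x + indicator_vec b))"
    proof -
      have "inj_on (insert i) (Pow a)" "Pow a \<inter> insert i ` Pow a = {}"
        using insert.hyps by (auto simp: inj_on_def)
      then show ?thesis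
        using insert.hyps by (simp add: Pow_insert sum.union_disjoint sum.reindex)
    qed
    finally show ?case .
  qed
qed

text \<open>
  The column of a matrix entry is written as the symmetric difference of the row \<open>c\<close> with a set \<open>d\<close>,
  since exactly the shift by \<open>d\<close> moves the point \<open>c\<close> to that column.
\<close>

lemma partial_ops_delta:
  "partial_ops a (delta_fun (sym_diff c d)) (indicator_vec c) = of_bool (d \<subseteq> a)"
proof -
  have "sym_diff c b = sym_diff c d \<longleftrightarrow> b = d" for b
    by blast
  then show ?thesis
    by (simp add: partial_ops_apply indicator_vec_add delta_fun_indicator_vec of_bool_def)
qed

lemma monomial_in_cube_End:
  "mult_op g \<otimes>\<^bsub>cube_End\<^esub> partial_ops a \<in> carrier cube_End"
  by (auto simp: carrier_cube_End cube_End_simps mult_op_def cube_functions_def fun_eq_iff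
      partial_ops_apply sum.distrib algebra_simps)

lemma operator_of_eq_sum:
  "operator_of A = (\<lambda>f x. \<Sum>s\<in>A. delta_fun (Inl -` s) x * partial_ops (Inr -` s) f x)"
  by (simp add: operator_of_def finsum_cube_End monomial_in_cube_End)
    (simp add: cube_End_simps mult_op_def cube_functions_def)

lemma operator_of_in_cube_End: "operator_of A \<in> carrier cube_End"
  by (auto simp: carrier_cube_End operator_of_eq_sum fun_eq_iff partial_ops_apply
      sum.distrib algebra_simps)

lemma Plus_vimage: "Sum_Type.Plus (Inl -` s) (Inr -` s) = s"
proof -
  have "x \<in> Sum_Type.Plus (Inl -` s) (Inr -` s) \<longleftrightarrow> x \<in> s" for x
    by (cases x) auto
  then show ?thesis
    by blast
qed

lemma vimage_Plus: "Inl -` Sum_Type.Plus c e = c" "Inr -` Sum_Type.Plus c e = e"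
  by auto

text \<open>
  At the point \<open>c\<close> the factor \<open>delta_fun (Inl -` s)\<close> vanishes unless the first half of \<open>s\<close> is \<open>c\<close>,
  so only the slice of \<open>A\<close> over \<open>c\<close> contributes.
\<close>

lemma operator_of_indicator_vec:
  "operator_of A f (indicator_vec c) =
    (\<Sum>e | Sum_Type.Plus c e \<in> A. partial_ops e f (indicator_vec c))"
proof -
  have delta: "delta_fun a (indicator_vec c) * y = (if c = a then y else 0)" for a y
    by (simp add: delta_fun_indicator_vec)
  have "operator_of A f (indicator_vec c) =
      (\<Sum>s\<in>A. if c = Inl -` s then partial_ops (Inr -` s) f (indicator_vec c) else 0)"
    by (simp only: operator_of_eq_sum delta)
  also have "\<dots> = (\<Sum>s | s \<in> A \<and> c = Inl -` s. partial_ops (Inr -` s) f (indicator_vec c))"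
    by (rule sum.inter_filter[symmetric]) simp
  also have "\<dots> = (\<Sum>e | Sum_Type.Plus c e \<in> A. partial_ops e f (indicator_vec c))"
    by (rule sum.reindex_bij_witness[of _ "Sum_Type.Plus c" "\<lambda>s. Inr -` s"])
      (auto simp: Plus_vimage vimage_Plus)
  finally show ?thesis .
qed

lemma operator_of_delta:
  "operator_of A (delta_fun (sym_diff c d)) (indicator_vec c) =
    (\<Sum>e | d \<subseteq> e. of_bool (Sum_Type.Plus c e \<in> A))"
  by (simp add: operator_of_indicator_vec partial_ops_delta of_bool_def conj_commute
    flip: sum.inter_filter)

text \<open>
  For \<open>e\<close> above \<open>a\<close> the coefficient of \<open>g e\<close> on the left is the number of sets between \<open>a\<close> and
  \<open>e\<close>, which is a power of two, hence zero modulo two unless \<open>e = a\<close>.  The proof obtains this from Moebius inversion for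
  sums over subsets by passing to complements; the signs there are \<open>1\<close> modulo two.
\<close>

lemma superset_sum_involution:
  fixes g :: "'n::finite set \<Rightarrow> bit"
  shows "(\<Sum>b | a \<subseteq> b. \<Sum>e | b \<subseteq> e. g e) = g a"
proof -
  have compl: "(\<Sum>b | a \<subseteq> b. h b) = (\<Sum>b\<in>Pow (- a). h (- b))" for h :: "'n set \<Rightarrow> bit" and a
    by (rule sum.reindex_bij_witness[of _ uminus uminus]) auto
  have "g (- (- a)) = (\<Sum>T\<in>Pow (- a). (- 1) ^ (card (- a) - card T) * (\<Sum>U\<in>Pow T. g (- U)))"
    by (rule inclusion_exclusion_mobius) simp_all
  then show ?thesis
    by (simp add: compl)
qed

text \<open>
  Applying the superset sum to the matrix of \<open>operator_of A\<close> recovers \<open>A\<close>, which gives injectivity.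
  Applying it to the matrix of an arbitrary endomorphism produces a family whose operator has that
  matrix, which gives surjectivity.
\<close>

lemma bij_operator_of:
  "bij_betw (operator_of :: ('n::finite + 'n) set set \<Rightarrow> _) UNIV (carrier cube_End)"
proof (rule bij_betw_imageI)
  have sym_diff_cancel: "sym_diff c (sym_diff c a) = a" for a c :: "'n set"
    by blast
  have mem: "of_bool (Sum_Type.Plus c a \<in> A) =
      (\<Sum>b | a \<subseteq> b. operator_of A (delta_fun (sym_diff c b)) (indicator_vec c))"
    for A and a c :: "'n set"
    by (simp only: operator_of_delta superset_sum_involution)
  show "inj (operator_of :: ('n + 'n) set set \<Rightarrow> _)"
  proof (rule injI)
    fix A B :: "('n + 'n) set set"
    assume eq: "operator_of A = operator_of B"
    have "Sum_Type.Plus c a \<in> A \<longleftrightarrow> Sum_Type.Plus c a \<in> B" for a c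
      using mem[of c a A] mem[of c a B] by (simp add: eq flip: of_bool_eq_iff[where 'a = bit])
    from this[of "Inl -` s" "Inr -` s" for s] have "s \<in> A \<longleftrightarrow> s \<in> B" for s
      by (simp only: Plus_vimage)
    then show "A = B"
      by blast
  qed
  show "range (operator_of :: ('n + 'n) set set \<Rightarrow> _) = carrier cube_End"
  proof (intro equalityI subsetI)
    fix T :: "(bit ^ 'n \<Rightarrow> bit) \<Rightarrow> bit ^ 'n \<Rightarrow> bit"
    assume T: "T \<in> carrier cube_End"
    \<comment> \<open>The matrix of \<open>T\<close>, with columns given relative to the row.\<close>
    define k where "k c b = T (delta_fun (sym_diff c b)) (indicator_vec c)" for c b
    define A where "A = {s. (\<Sum>b | Inr -` s \<subseteq> b. k (Inl -` s) b) = 1}"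
    have A: "of_bool (Sum_Type.Plus c e \<in> A) = (\<Sum>b | e \<subseteq> b. k c b)" for c e
      by (simp only: A_def mem_Collect_eq vimage_Plus of_bool_eq_one)
    have k: "operator_of A (delta_fun (sym_diff c d)) (indicator_vec c) = k c d" for c d
      by (simp only: operator_of_delta A superset_sum_involution)
    have "operator_of A (delta_fun a) (indicator_vec c) = T (delta_fun a) (indicator_vec c)"
      for a c
      using k[of c "sym_diff c a"] by (simp only: k_def sym_diff_cancel)
    then have "operator_of A = T"
      by (rule cube_End_eqI[OF operator_of_in_cube_End T])
    then show "T \<in> range operator_of" by blast
  qed (auto simp: operator_of_in_cube_End)
qed

section \<open>Transporting the structure to families of subsets\<close>

text \<open>
  The summands over the intersection occur twice on the right and cancel.
\<close>

lemma sum_sym_diff_bit: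
  fixes h :: "'i \<Rightarrow> bit"
  assumes "finite A" "finite B"
  shows "(\<Sum>a\<in>A \<union> B - A \<inter> B. h a) = (\<Sum>a\<in>A. h a) + (\<Sum>a\<in>B. h a)"
proof -
  have "(\<Sum>a\<in>A. h a) + (\<Sum>a\<in>B. h a) =
      (\<Sum>a\<in>A - B. h a) + (\<Sum>a\<in>B - A. h a) + ((\<Sum>a\<in>A \<inter> B. h a) + (\<Sum>a\<in>A \<inter> B. h a))"
    using assms sum.Int_Diff[of A h B] sum.Int_Diff[of B h A] by (simp add: Int_commute ac_simps)
  also have "\<dots> = (\<Sum>a\<in>(A - B) \<union> (B - A). h a)"
    using assms by (subst sum.union_disjoint) auto
  also have "(A - B) \<union> (B - A) = A \<union> B - A \<inter> B"
    by blast
  finally show ?thesis by simp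
qed

lemma operator_of_linear: "operator_of \<in> linear_maps Z2 (symdiff_structure mul u) cube_End"
  by (auto simp: linear_maps_def symdiff_structure_def operator_of_in_cube_End cube_End_simps)
    (simp_all add: operator_of_eq_sum sum_sym_diff_bit)

lemma function_of_linear: "function_of \<in> linear_maps Z2 (symdiff_structure mul u) cube_functions"
  by (auto simp: linear_maps_def symdiff_structure_def)
    (simp_all add: function_of_eq_sum sum_sym_diff_bit cube_functions_def)

theorem theorem42:
  "\<exists>(circ :: ('n::finite + 'n) set set \<Rightarrow> ('n + 'n) set set \<Rightarrow> ('n + 'n) set set)
    (circ_act :: ('n + 'n) set set \<Rightarrow> 'n set set \<Rightarrow> 'n set set)
    (unit :: ('n + 'n) set set).
      assoc_algebra Z2 (symdiff_structure circ unit) \<and>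
      algebra_module_pair Z2 (symdiff_structure circ unit) symdiff_module circ_act \<and>
      pair_iso Z2
        (symdiff_structure circ unit) symdiff_module circ_act
        cube_End cube_functions (\<lambda>T f. T f)
        operator_of function_of"
proof -
  let ?E = "cube_End :: (bit, (bit ^ 'n \<Rightarrow> bit) \<Rightarrow> _) module"
  let ?V = "cube_functions :: (bit, bit ^ 'n \<Rightarrow> bit) module"
  \<comment> \<open>The operations on families are composition, evaluation and identity, read through the
    bijections.\<close>
  let ?symbol = "inv_into UNIV operator_of :: _ \<Rightarrow> ('n + 'n) set set"
  let ?support = "inv_into UNIV function_of :: _ \<Rightarrow> 'n set set"
  define circ where "circ A B = ?symbol (operator_of A \<otimes>\<^bsub>?E\<^esub> operator_of B)" for A B
  define circ_act where "circ_act A F = ?support (operator_of A (function_of F))" for A F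
  define unit where "unit = ?symbol \<one>\<^bsub>?E\<^esub>"
  let ?A = "symdiff_structure circ unit" and ?M = "symdiff_module :: (bit, 'n set set) module"
  interpret E: assoc_algebra Z2 ?E
    by (rule assoc_algebra_cube_End)
  have symbol: "operator_of (?symbol T) = T" if "T \<in> carrier ?E" for T
    using that bij_operator_of by (metis bij_betw_imp_surj_on f_inv_into_f)
  have circ: "operator_of (circ A B) = operator_of A \<otimes>\<^bsub>?E\<^esub> operator_of B" for A B
    by (simp add: circ_def symbol operator_of_in_cube_End)
  have unit: "operator_of unit = \<one>\<^bsub>?E\<^esub>"
    by (simp add: unit_def symbol)
  have circ_act: "function_of (circ_act A F) = operator_of A (function_of F)" for A F
    by (simp add: circ_act_def surj_f_inv_f[OF bij_is_surj[OF bij_function_of]])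
  have bij_E: "bij_betw operator_of (carrier ?A) (carrier ?E)"
    and bij_V: "bij_betw function_of (carrier ?M) (carrier ?V)"
    using bij_operator_of bij_function_of
    by (simp_all add: symdiff_structure_def symdiff_module_def)
  have lin_V: "function_of \<in> linear_maps Z2 ?M ?V"
    by (simp add: symdiff_module_def function_of_linear)
  have ring_E: "operator_of \<in> ring_hom ?A ?E"
    using linear_mapsD[OF operator_of_linear[of circ unit]] circ unit
    by (intro ring_hom_memI) (simp_all add: symdiff_structure_def)
  have alg: "assoc_algebra Z2 ?A"
    by (rule assoc_algebra_pullback[OF assoc_algebra_cube_End bij_E operator_of_linear ring_E])
      (simp_all add: symdiff_structure_def operator_of_eq_sum cube_End_simps)
  have mod: "Module.module Z2 ?M"
    by (rule module_pullback[OF module_cube_functions bij_V lin_V])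
      (simp_all add: symdiff_module_def symdiff_structure_def function_of_eq_sum cube_functions_def)
  have hom: "pair_hom Z2 ?A ?M circ_act ?E ?V (\<lambda>T f. T f) operator_of function_of"
    by (rule pair_hom_pullback[OF algebra_module_pair_cube alg mod operator_of_linear ring_E lin_V
          bij_betw_imp_inj_on[OF bij_V]])
      (simp_all add: symdiff_module_def symdiff_structure_def circ_act)
  from hom have "algebra_module_pair Z2 ?A ?M circ_act"
    by (simp add: pair_hom_def)
  moreover have "pair_iso Z2 ?A ?M circ_act ?E ?V (\<lambda>T f. T f) operator_of function_of"
    by (rule pair_iso_of_bijective_hom[OF hom bij_E bij_V])
  ultimately show ?thesis
    using alg by blast
qed

end
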